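(* There is no non-adaptive one-sided unique decoding coding scheme for the $n$-bit one-lookup protocol that tolerates an error rate of $1/3$, has an $o(n)$ alphabet size, and runs in $2^{o(n)}$ rounds while having failure probability $o(1)$.
   Context: The $n$-bit one-lookup problem: Alice gets $x\in\{0,1\}^n$ and Bob gets $2^n$ bits $y_1,\ldots,y_{2^n}\in\{0,1\}$ (indexed by $\{0,1\}^n$); the one-lookup protocol consists of Alice sending $x$ to Bob and Bob replying with $y_x$. A coding scheme simulates it by an $N$-round protocol in which (non-adaptively) the transmitting party of each round is fixed in advance, exactly one party per round; an adversary may replace any transmitted symbol arbitrarily, and error rate $\rho$ means at most $\rho N$ corruptions. One-sided unique decoding: Alice must, from any execution with at most a $\rho$ fraction of corruptions, output the outcome of the error-free protocol (i.e., $y_x$). Parties may use private randomness; failure probability $p$ means that for every input and adversary, Alice decodes correctly with probability at least $1-p$. *)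

theory Defs
  imports "HOL-Probability.Probability" "HOL-Library.Landau_Symbols"
begin

text \<open>Bob's \<open>2 ^ n\<close> bits are indexed by \<open>{0,1}\<^sup>n\<close>.\<close>

definition alice_inputs :: "nat \<Rightarrow> bool list set" where
  "alice_inputs n = {x. length x = n}"

definition bob_inputs :: "nat \<Rightarrow> (bool list \<Rightarrow> bool) set" where
  "bob_inputs n = alice_inputs n \<rightarrow>\<^sub>E UNIV"

text \<open>Outcome of the error-free protocol in which Alice sends \<open>x\<close> and Bob replies with \<open>y\<^sub>x\<close>.\<close>

definition one_lookup :: "bool list \<Rightarrow> (bool list \<Rightarrow> bool) \<Rightarrow> bool" where
  "one_lookup x y = y x"

datatype party = Alice | Bob

text \<open>
  Non-adaptivity is built in: \<open>speaker\<close> depends on the round number only. Private randomness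
  is a seed drawn from a party's own probability space before the first round. A party acts on
  the round number, its input, its seed and the symbols received so far; its own earlier symbols
  are determined by these.
\<close>

record ('c, 'r, 's) coding_scheme =
  rounds :: nat
  alphabet :: "'c set"
  speaker :: "nat \<Rightarrow> party"
  alice_seed :: "'r measure"
  bob_seed :: "'s measure"
  alice_send :: "nat \<Rightarrow> bool list \<Rightarrow> 'r \<Rightarrow> 'c list \<Rightarrow> 'c"
  bob_send :: "nat \<Rightarrow> (bool list \<Rightarrow> bool) \<Rightarrow> 's \<Rightarrow> 'c list \<Rightarrow> 'c"
  alice_output :: "bool list \<Rightarrow> 'r \<Rightarrow> 'c list \<Rightarrow> bool"

definition well_formed :: "nat \<Rightarrow> ('c, 'r, 's) coding_scheme \<Rightarrow> bool" where
  "well_formed n S \<longleftrightarrow>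
     finite (alphabet S) \<and> prob_space (alice_seed S) \<and> prob_space (bob_seed S) \<and>
     (\<forall>i<rounds S. speaker S i = Alice \<longrightarrow>
        (\<forall>x\<in>alice_inputs n. \<forall>h\<in>lists (alphabet S).
           (\<lambda>r. alice_send S i x r h) \<in> alice_seed S \<rightarrow>\<^sub>M count_space (alphabet S))) \<and>
     (\<forall>i<rounds S. speaker S i = Bob \<longrightarrow>
        (\<forall>y\<in>bob_inputs n. \<forall>h\<in>lists (alphabet S).
           (\<lambda>s. bob_send S i y s h) \<in> bob_seed S \<rightarrow>\<^sub>M count_space (alphabet S))) \<and>
     (\<forall>x\<in>alice_inputs n. \<forall>h\<in>lists (alphabet S).
        (\<lambda>r. alice_output S x r h) \<in> alice_seed S \<rightarrow>\<^sub>M count_space UNIV)"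

text \<open>
  An adversary sees all symbols transmitted so far, the current one included (last), and
  determines the symbol that is delivered in the current round. It has error rate \<open>\<rho>\<close> if it
  changes at most \<open>\<rho> N\<close> of the symbols, whatever sequence of \<open>N\<close> symbols is transmitted.
\<close>

type_synonym 'c adversary = "'c list \<Rightarrow> 'c"

definition adversary_of_rate :: "'c set \<Rightarrow> nat \<Rightarrow> real \<Rightarrow> 'c adversary \<Rightarrow> bool" where
  "adversary_of_rate \<Sigma> N \<rho> adv \<longleftrightarrow>
     (\<forall>w\<in>lists \<Sigma>. length w = N \<longrightarrow>
        (\<forall>i<N. adv (take (Suc i) w) \<in> \<Sigma>) \<and>
        real (card {i. i < N \<and> adv (take (Suc i) w) \<noteq> w ! i}) \<le> \<rho> * real N)"

text \<open>Executions are recorded as lists of pairs (transmitted symbol, delivered symbol).\<close>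

definition received_by ::
  "party \<Rightarrow> ('c, 'r, 's) coding_scheme \<Rightarrow> ('c \<times> 'c) list \<Rightarrow> 'c list" where
  "received_by P S h = nths (map snd h) {i. speaker S i \<noteq> P}"

primrec execution ::
  "('c, 'r, 's) coding_scheme \<Rightarrow> 'c adversary \<Rightarrow> bool list \<Rightarrow> (bool list \<Rightarrow> bool) \<Rightarrow> 'r \<Rightarrow> 's \<Rightarrow>
     nat \<Rightarrow> ('c \<times> 'c) list" where
  "execution S adv x y r s 0 = []"
| "execution S adv x y r s (Suc i) =
     (let h = execution S adv x y r s i;
          c = (case speaker S i of
                 Alice \<Rightarrow> alice_send S i x r (received_by Alice S h)
               | Bob \<Rightarrow> bob_send S i y s (received_by Bob S h))
      in h @ [(c, adv (map fst h @ [c]))])"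

definition alice_decodes ::
  "('c, 'r, 's) coding_scheme \<Rightarrow> 'c adversary \<Rightarrow> bool list \<Rightarrow> (bool list \<Rightarrow> bool) \<Rightarrow> 'r \<Rightarrow> 's \<Rightarrow> bool"
where
  "alice_decodes S adv x y r s \<longleftrightarrow>
     alice_output S x r (received_by Alice S (execution S adv x y r s (rounds S))) = one_lookup x y"

definition one_sided_unique_decoding_scheme ::
  "nat \<Rightarrow> real \<Rightarrow> real \<Rightarrow> ('c, 'r, 's) coding_scheme \<Rightarrow> bool" where
  "one_sided_unique_decoding_scheme n \<rho> p S \<longleftrightarrow>
     well_formed n S \<and>
     (\<forall>x\<in>alice_inputs n. \<forall>y\<in>bob_inputs n. \<forall>adv.
        adversary_of_rate (alphabet S) (rounds S) \<rho> adv \<longrightarrow>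
        measure (alice_seed S \<Otimes>\<^sub>M bob_seed S)
          {(r, s) \<in> space (alice_seed S \<Otimes>\<^sub>M bob_seed S). alice_decodes S adv x y r s} \<ge> 1 - p)"

end

theory Submission
  imports Defs "HOL-Real_Asymp.Real_Asymp"
begin

text \<open>
  Let \<open>t = \<lfloor>N / 3\<rfloor>\<close>. If Bob speaks in at most \<open>2 t\<close> rounds, the adversary can deliver half of Bob's
  symbols as computed from \<open>y\<close> and the other half as computed from some \<open>y'\<close> with
  \<open>y'\<^sub>x \<noteq> y\<^sub>x\<close>. Alice's view then has the same distribution whether Bob holds \<open>y\<close> or \<open>y'\<close>, so one
  of the two inputs is decoded wrongly with probability at least \<open>1/2\<close>.

  Otherwise Alice speaks in at most \<open>t + 1\<close> rounds, and the adversary can overwrite all but one of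
  her symbols by a constant. Once the seeds are fixed, what Bob sends is a function of \<open>y\<close> and of
  the one surviving symbol, so the vector of Alice's guesses for all \<open>x\<close> takes at most
  \<open>|\<Sigma>| ^ (N |\<Sigma>|)\<close> values, which is \<open>2 ^ 2 ^ o(n)\<close>. So few vectors cannot approximate a uniformly random
  \<open>y\<close>, which has \<open>2 ^ n\<close> bits, on three quarters of its coordinates. The second case must cover
  \<open>t + 1\<close> rounds, not only \<open>t\<close>, because of the rounding when \<open>N mod 3 = 2\<close>.
\<close>

section \<open>Sizes of the input sets and symbols within the alphabet\<close>

lemma length_execution [simp]: "length (execution S adv x y r s i) = i"
  by (induction i) (auto simp: Let_def)

lemma finite_alice_inputs [simp]: "finite (alice_inputs n)"
  using finite_lists_length_eq[of "UNIV :: bool set" n] by (simp add: alice_inputs_def)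

lemma card_alice_inputs: "card (alice_inputs n) = 2 ^ n"
  using card_lists_length_eq[of "UNIV :: bool set" n] by (simp add: alice_inputs_def)

lemma finite_bob_inputs [simp]: "finite (bob_inputs n)"
  by (simp add: bob_inputs_def finite_PiE)

lemma card_bob_inputs: "card (bob_inputs n) = 2 ^ 2 ^ n"
  by (simp add: bob_inputs_def card_PiE card_alice_inputs)

lemma alice_send_in_alphabet:
  assumes "well_formed n S" "i < rounds S" "speaker S i = Alice" "x \<in> alice_inputs n"
    "h \<in> lists (alphabet S)" "r \<in> space (alice_seed S)"
  shows "alice_send S i x r h \<in> alphabet S"
proof -
  have "(\<lambda>r. alice_send S i x r h) \<in> alice_seed S \<rightarrow>\<^sub>M count_space (alphabet S)"
    using assms by (auto simp: well_formed_def)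
  from measurable_space[OF this assms(6)] show ?thesis by simp
qed

lemma bob_send_in_alphabet:
  assumes "well_formed n S" "i < rounds S" "speaker S i = Bob" "y \<in> bob_inputs n"
    "h \<in> lists (alphabet S)" "s \<in> space (bob_seed S)"
  shows "bob_send S i y s h \<in> alphabet S"
proof -
  have "(\<lambda>s. bob_send S i y s h) \<in> bob_seed S \<rightarrow>\<^sub>M count_space (alphabet S)"
    using assms by (auto simp: well_formed_def)
  from measurable_space[OF this assms(6)] show ?thesis by simp
qed

lemma nths_in_lists: "w \<in> lists A \<Longrightarrow> nths w I \<in> lists A"
  using set_nths_subset[of w I] by (auto simp: in_lists_conv_set)

subsection \<open>Mixing two inputs of Bob\<close>

text \<open>The delivered symbols when two Bobs, \<open>(y, s)\<close> and \<open>(y', s')\<close>,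
  both hear Alice's genuine symbols and \<open>J\<close> decides whose reply she receives. The
  recursion mentions no adversary, which makes the two Bobs interchangeable.\<close>

primrec mixed ::
  "('c, 'r, 's) coding_scheme \<Rightarrow> nat set \<Rightarrow> bool list \<Rightarrow> (bool list \<Rightarrow> bool) \<Rightarrow>
     (bool list \<Rightarrow> bool) \<Rightarrow> 'r \<Rightarrow> 's \<Rightarrow> 's \<Rightarrow> nat \<Rightarrow> 'c list" where
  "mixed S J x y y' r s s' 0 = []"
| "mixed S J x y y' r s s' (Suc i) =
     (let w = mixed S J x y y' r s s' i
      in w @ [case speaker S i of
                Alice \<Rightarrow> alice_send S i x r (nths w {j. speaker S j \<noteq> Alice})
              | Bob \<Rightarrow> if i \<in> J then bob_send S i y s (nths w {j. speaker S j \<noteq> Bob})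
                       else bob_send S i y' s' (nths w {j. speaker S j \<noteq> Bob})])"

text \<open>The current symbol is last in \<open>w\<close>, so \<open>length w - 1\<close> is the
  current round. The seed \<open>s'\<close> of the simulated Bob is a parameter because adversaries
  are deterministic; it is averaged over later.\<close>

definition mixing_adversary ::
  "('c, 'r, 's) coding_scheme \<Rightarrow> nat set \<Rightarrow> (bool list \<Rightarrow> bool) \<Rightarrow> 's \<Rightarrow> 'c adversary" where
  "mixing_adversary S J y' s' w =
     (if speaker S (length w - 1) = Bob \<and> length w - 1 \<notin> J
      then bob_send S (length w - 1) y' s' (nths (butlast w) {j. speaker S j \<noteq> Bob})
      else last w)"

lemma length_mixed [simp]: "length (mixed S J x y y' r s s' i) = i"
  by (induction i) (auto simp: Let_def)

text \<open>Complementing \<open>J\<close> exchanges the real and the simulated Bob, so the same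
  transcript arises from both inputs.\<close>

lemma mixed_swap: "mixed S (- J) x y' y r s' s i = mixed S J x y y' r s s' i"
  by (induction i) (auto simp: Let_def split: party.split)

text \<open>The second conjunct carries the induction: the adversary sees transmitted symbols,
  \<open>mixed\<close> uses delivered ones, and they agree in Alice's rounds, which are never
  corrupted.\<close>

lemma execution_mixing_adversary:
  "map snd (execution S (mixing_adversary S J y' s') x y r s i) = mixed S J x y y' r s s' i \<and>
   nths (map fst (execution S (mixing_adversary S J y' s') x y r s i)) {j. speaker S j \<noteq> Bob} =
   nths (map snd (execution S (mixing_adversary S J y' s') x y r s i)) {j. speaker S j \<noteq> Bob}"
  by (induction i)
    (auto simp: Let_def received_by_def mixing_adversary_def nths_append split: party.split)

lemma mixing_adversary_of_rate:
  assumes wf: "well_formed n S" and y': "y' \<in> bob_inputs n" and s': "s' \<in> space (bob_seed S)"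
    and J: "real (card {i. i < rounds S \<and> speaker S i = Bob \<and> i \<notin> J}) \<le> \<rho> * real (rounds S)"
  shows "adversary_of_rate (alphabet S) (rounds S) \<rho> (mixing_adversary S J y' s')"
  unfolding adversary_of_rate_def
proof (intro ballI impI conjI allI)
  fix w assume w: "w \<in> lists (alphabet S)" "length w = rounds S"
  have last: "last (take (Suc i) w) = w ! i" if "i < rounds S" for i
    using that w by (simp add: take_Suc_conv_app_nth)
  show "mixing_adversary S J y' s' (take (Suc i) w) \<in> alphabet S" if i: "i < rounds S" for i
  proof -
    have "nths (butlast (take (Suc i) w)) {j. speaker S j \<noteq> Bob} \<in> lists (alphabet S)"
      using w by (intro nths_in_lists) (auto simp: in_lists_conv_set dest: in_set_butlastD in_set_takeD)
    moreover have "w ! i \<in> alphabet S" using w i by (auto simp: in_lists_conv_set)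
    ultimately show ?thesis
      using bob_send_in_alphabet[OF wf i _ y' _ s'] w i by (auto simp: mixing_adversary_def last)
  qed
  have "card {i. i < rounds S \<and> mixing_adversary S J y' s' (take (Suc i) w) \<noteq> w ! i}
      \<le> card {i. i < rounds S \<and> speaker S i = Bob \<and> i \<notin> J}"
    using w by (intro card_mono) (auto simp: mixing_adversary_def last split: if_splits)
  with J show "real (card {i. i < rounds S \<and> mixing_adversary S J y' s' (take (Suc i) w) \<noteq> w ! i})
      \<le> \<rho> * real (rounds S)" by linarith
qed

text \<open>Each symbol is measurable for a fixed history, and over a finite alphabet there are only
  countably many histories to insert.\<close>

lemma mixed_measurable:
  assumes wf: "well_formed n S" and x: "x \<in> alice_inputs n"
    and y: "y \<in> bob_inputs n" "y' \<in> bob_inputs n"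
  shows "i \<le> rounds S \<Longrightarrow> (\<lambda>(r, s, s'). mixed S J x y y' r s s' i)
    \<in> alice_seed S \<Otimes>\<^sub>M (bob_seed S \<Otimes>\<^sub>M bob_seed S) \<rightarrow>\<^sub>M count_space (lists (alphabet S))"
proof (induction i)
  case 0
  then show ?case by simp
next
  case (Suc i)
  let ?A = "alice_seed S" and ?B = "bob_seed S"
  let ?\<Sigma> = "alphabet S"
  let ?M = "?A \<Otimes>\<^sub>M (?B \<Otimes>\<^sub>M ?B)"
  define g where "g = (\<lambda>w \<omega>. case speaker S i of
                Alice \<Rightarrow> alice_send S i x (fst \<omega>) (nths w {j. speaker S j \<noteq> Alice})
              | Bob \<Rightarrow> if i \<in> J then bob_send S i y (fst (snd \<omega>)) (nths w {j. speaker S j \<noteq> Bob})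
                       else bob_send S i y' (snd (snd \<omega>)) (nths w {j. speaker S j \<noteq> Bob}))"
  have g: "g w \<in> ?M \<rightarrow>\<^sub>M count_space ?\<Sigma>" if w: "w \<in> lists ?\<Sigma>" for w
  proof (cases "speaker S i")
    case Alice
    have "(\<lambda>r. alice_send S i x r (nths w {j. speaker S j \<noteq> Alice})) \<in> ?A \<rightarrow>\<^sub>M count_space ?\<Sigma>"
      using wf x Alice Suc.prems nths_in_lists[OF w] by (auto simp: well_formed_def)
    from measurable_compose[OF measurable_fst this] show ?thesis
      by (simp add: g_def Alice)
  next
    case Bob
    have b: "(\<lambda>s. bob_send S i z s (nths w {j. speaker S j \<noteq> Bob})) \<in> ?B \<rightarrow>\<^sub>M count_space ?\<Sigma>"
      if "z \<in> bob_inputs n" for z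
      using wf that Bob Suc.prems nths_in_lists[OF w] by (auto simp: well_formed_def)
    have "(\<lambda>\<omega>. fst (snd \<omega>)) \<in> ?M \<rightarrow>\<^sub>M ?B" "(\<lambda>\<omega>. snd (snd \<omega>)) \<in> ?M \<rightarrow>\<^sub>M ?B" by measurable
    from measurable_compose[OF this(1) b[OF y(1)]] measurable_compose[OF this(2) b[OF y(2)]]
    show ?thesis
      by (cases "i \<in> J") (simp_all add: g_def Bob)
  qed
  have *: "(\<lambda>\<omega>. w @ [g w \<omega>]) \<in> ?M \<rightarrow>\<^sub>M count_space (lists ?\<Sigma>)" if w: "w \<in> lists ?\<Sigma>" for w
    by (rule measurable_compose[OF g[OF w]]) (use w in auto)
  have "countable (lists ?\<Sigma>)"
    using wf by (intro countable_lists countable_finite) (simp add: well_formed_def)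
  from measurable_compose_countable'[OF * Suc.IH this] Suc.prems
  have "(\<lambda>\<omega>. (case \<omega> of (r, s, s') \<Rightarrow> mixed S J x y y' r s s' i) @
      [g (case \<omega> of (r, s, s') \<Rightarrow> mixed S J x y y' r s s' i) \<omega>]) \<in> ?M \<rightarrow>\<^sub>M count_space (lists ?\<Sigma>)"
    by simp
  then show ?case
    by (simp add: g_def Let_def case_prod_unfold)
qed

text \<open>Alice's output on the mixed transcript is one function of three independent seeds. It
  must be right for \<open>y\<close> when \<open>s'\<close> is simulated, and for \<open>y'\<close>
  when \<open>s\<close> is. These are disjoint events of probability at least \<open>1 - p\<close>
  each.\<close>

lemma failure_probability_of_mixing:
  assumes scheme: "one_sided_unique_decoding_scheme n \<rho> p S"
    and J: "real (card {i. i < rounds S \<and> speaker S i = Bob \<and> i \<notin> J}) \<le> \<rho> * real (rounds S)"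
      "real (card {i. i < rounds S \<and> speaker S i = Bob \<and> i \<in> J}) \<le> \<rho> * real (rounds S)"
  shows "p \<ge> 1/2"
proof (rule ccontr)
  assume p: "\<not> p \<ge> 1/2"
  let ?A = "alice_seed S" and ?B = "bob_seed S" and ?\<Sigma> = "alphabet S"
  have wf: "well_formed n S" using scheme by (simp add: one_sided_unique_decoding_scheme_def)
  interpret A: prob_space ?A using wf by (simp add: well_formed_def)
  interpret B: prob_space ?B using wf by (simp add: well_formed_def)
  interpret AB: pair_prob_space ?A ?B ..
  interpret BB: pair_prob_space ?B ?B ..
  interpret ABB: pair_prob_space ?A "?B \<Otimes>\<^sub>M ?B" ..
  define x where "x = replicate n False"
  define y where "y = (\<lambda>z\<in>alice_inputs n. True)"
  define y' where "y' = (\<lambda>z\<in>alice_inputs n. False)"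
  have x: "x \<in> alice_inputs n" by (simp add: x_def alice_inputs_def)
  have y: "y \<in> bob_inputs n" "y' \<in> bob_inputs n" by (auto simp: y_def y'_def bob_inputs_def)
  define out where "out = (\<lambda>r s s'. alice_output S x r
     (nths (mixed S J x y y' r s s' (rounds S)) {j. speaker S j \<noteq> Alice}))"
  have out: "(\<lambda>(r, s, s'). out r s s') \<in> ?A \<Otimes>\<^sub>M (?B \<Otimes>\<^sub>M ?B) \<rightarrow>\<^sub>M count_space UNIV"
  proof -
    have *: "(\<lambda>\<omega>. alice_output S x (fst \<omega>) (nths w {j. speaker S j \<noteq> Alice}))
      \<in> ?A \<Otimes>\<^sub>M (?B \<Otimes>\<^sub>M ?B) \<rightarrow>\<^sub>M count_space UNIV" if w: "w \<in> lists ?\<Sigma>" for w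
    proof -
      have "(\<lambda>r. alice_output S x r (nths w {j. speaker S j \<noteq> Alice})) \<in> ?A \<rightarrow>\<^sub>M count_space UNIV"
        using wf x nths_in_lists[OF w] by (auto simp: well_formed_def)
      from measurable_compose[OF measurable_fst this] show ?thesis .
    qed
    have "countable (lists ?\<Sigma>)"
      using wf by (intro countable_lists countable_finite) (simp add: well_formed_def)
    from measurable_compose_countable'[OF * mixed_measurable[OF wf x y order_refl] this]
    show ?thesis by (simp add: out_def case_prod_unfold)
  qed
  define E where "E = (\<lambda>b. {\<omega> \<in> space (?A \<Otimes>\<^sub>M (?B \<Otimes>\<^sub>M ?B)). (\<lambda>(r, s, s'). out r s s') \<omega> = b})"
  have E: "E b \<in> sets (?A \<Otimes>\<^sub>M (?B \<Otimes>\<^sub>M ?B))" for b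
    unfolding E_def using measurable_sets[OF out, of "{b}"] by (simp add: vimage_def Int_def conj_commute)
  \<comment> \<open>\<open>G b q\<close> is the probability over Alice's seed alone that she outputs
    \<open>b\<close> when the two Bob seeds are \<open>q\<close>.\<close>
  define G where "G = (\<lambda>b q. emeasure ?A ((\<lambda>r. (r, q)) -` E b))"
  have G: "G b \<in> borel_measurable (?B \<Otimes>\<^sub>M ?B)" for b
    unfolding G_def by (rule ABB.measurable_emeasure_Pair2[OF E])
  have slice: "(\<lambda>r. (r, s, s')) -` E b = {r \<in> space ?A. out r s s' = b}"
    if "s \<in> space ?B" "s' \<in> space ?B" for b s s'
    using that by (auto simp: E_def space_pair_measure)
  have decode: "ennreal (1 - p) \<le> (\<integral>\<^sup>+ s. emeasure ?A {r \<in> space ?A. alice_decodes S adv x z r s} \<partial>?B)"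
    if "adversary_of_rate ?\<Sigma> (rounds S) \<rho> adv" "z \<in> bob_inputs n" for adv z
  proof -
    let ?D = "{(r, s) \<in> space (?A \<Otimes>\<^sub>M ?B). alice_decodes S adv x z r s}"
    have D: "measure (?A \<Otimes>\<^sub>M ?B) ?D \<ge> 1 - p"
      using scheme x that unfolding one_sided_unique_decoding_scheme_def by blast
    \<comment> \<open>Non-measurable sets have \<open>measure\<close> 0.\<close>
    with p have sets: "?D \<in> sets (?A \<Otimes>\<^sub>M ?B)"
      using measure_notin_sets[of ?D "?A \<Otimes>\<^sub>M ?B"] by force
    have "ennreal (1 - p) \<le> emeasure (?A \<Otimes>\<^sub>M ?B) ?D"
      using D by (simp add: AB.P.emeasure_eq_measure ennreal_leI)
    also have "\<dots> = (\<integral>\<^sup>+ s. emeasure ?A ((\<lambda>r. (r, s)) -` ?D) \<partial>?B)"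
      by (rule AB.emeasure_pair_measure_alt2[OF sets])
    also have "\<dots> = (\<integral>\<^sup>+ s. emeasure ?A {r \<in> space ?A. alice_decodes S adv x z r s} \<partial>?B)"
      by (intro nn_integral_cong arg_cong[of _ _ "emeasure ?A"]) (auto simp: space_pair_measure)
    finally show ?thesis .
  qed
  have 1: "ennreal (1 - p) \<le> (\<integral>\<^sup>+ s. G True (s, s') \<partial>?B)" if s': "s' \<in> space ?B" for s'
  proof -
    note decode[OF mixing_adversary_of_rate[OF wf y(2) s' J(1)] y(1)]
    also have "(\<integral>\<^sup>+ s. emeasure ?A {r \<in> space ?A. alice_decodes S (mixing_adversary S J y' s') x y r s} \<partial>?B)
       = (\<integral>\<^sup>+ s. G True (s, s') \<partial>?B)"
      using s' x by (intro nn_integral_cong)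
        (simp add: G_def slice out_def alice_decodes_def received_by_def one_lookup_def
          execution_mixing_adversary y_def)
    finally show ?thesis .
  qed
  have 2: "ennreal (1 - p) \<le> (\<integral>\<^sup>+ s'. G False (s, s') \<partial>?B)" if s: "s \<in> space ?B" for s
  proof -
    \<comment> \<open>With \<open>- J\<close> the simulated Bob holds \<open>y\<close> and
      overwrites Bob's rounds in \<open>J\<close>.\<close>
    have "real (card {i. i < rounds S \<and> speaker S i = Bob \<and> i \<notin> - J}) \<le> \<rho> * real (rounds S)"
      using J(2) by simp
    note decode[OF mixing_adversary_of_rate[OF wf y(1) s this] y(2)]
    also have "(\<integral>\<^sup>+ s'. emeasure ?A {r \<in> space ?A. alice_decodes S (mixing_adversary S (- J) y s) x y' r s'} \<partial>?B)
       = (\<integral>\<^sup>+ s'. G False (s, s') \<partial>?B)"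
      using s x by (intro nn_integral_cong)
        (simp add: G_def slice out_def alice_decodes_def received_by_def one_lookup_def
          execution_mixing_adversary mixed_swap y'_def)
    finally show ?thesis .
  qed
  have le: "G True (s, s') + G False (s, s') \<le> 1" if "s \<in> space ?B" "s' \<in> space ?B" for s s'
  proof -
    have sets: "{r \<in> space ?A. out r s s' = b} \<in> sets ?A" for b
      using sets_Pair2[OF E[of b], of "(s, s')"] slice[OF that] by simp
    have "G True (s, s') + G False (s, s')
        = emeasure ?A ({r \<in> space ?A. out r s s' = True} \<union> {r \<in> space ?A. out r s s' = False})"
      unfolding G_def slice[OF that] by (intro plus_emeasure sets) auto
    also have "\<dots> \<le> 1" by (rule A.emeasure_le_1)
    finally show ?thesis .
  qed
  \<comment> \<open>The bounds hold for every fixed simulated seed, hence also on average over it.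
    Fubini brings the first average into the order of the second.\<close>
  have "ennreal (1 - p) = (\<integral>\<^sup>+ s'. ennreal (1 - p) \<partial>?B)"
    by (simp add: B.emeasure_space_1)
  also have "\<dots> \<le> (\<integral>\<^sup>+ s'. \<integral>\<^sup>+ s. G True (s, s') \<partial>?B \<partial>?B)"
    by (intro nn_integral_mono 1)
  also have "\<dots> = (\<integral>\<^sup>+ s. \<integral>\<^sup>+ s'. G True (s, s') \<partial>?B \<partial>?B)"
    by (rule BB.Fubini[OF G])
  finally have i1: "ennreal (1 - p) \<le> (\<integral>\<^sup>+ s. \<integral>\<^sup>+ s'. G True (s, s') \<partial>?B \<partial>?B)" .
  have "ennreal (1 - p) = (\<integral>\<^sup>+ s. ennreal (1 - p) \<partial>?B)"
    by (simp add: B.emeasure_space_1)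
  also have "\<dots> \<le> (\<integral>\<^sup>+ s. \<integral>\<^sup>+ s'. G False (s, s') \<partial>?B \<partial>?B)"
    by (intro nn_integral_mono 2)
  finally have i2: "ennreal (1 - p) \<le> (\<integral>\<^sup>+ s. \<integral>\<^sup>+ s'. G False (s, s') \<partial>?B \<partial>?B)" .
  have m: "(\<lambda>s. \<integral>\<^sup>+ s'. G b (s, s') \<partial>?B) \<in> borel_measurable ?B" for b
    using B.borel_measurable_nn_integral_fst[OF G] .
  have "ennreal (1 - p) + ennreal (1 - p) \<le>
      (\<integral>\<^sup>+ s. \<integral>\<^sup>+ s'. G True (s, s') \<partial>?B \<partial>?B) + (\<integral>\<^sup>+ s. \<integral>\<^sup>+ s'. G False (s, s') \<partial>?B \<partial>?B)"
    by (intro add_mono i1 i2)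
  also have "\<dots> = (\<integral>\<^sup>+ s. (\<integral>\<^sup>+ s'. G True (s, s') \<partial>?B) + (\<integral>\<^sup>+ s'. G False (s, s') \<partial>?B) \<partial>?B)"
    by (rule nn_integral_add[symmetric]) (rule m)+
  also have "\<dots> = (\<integral>\<^sup>+ s. \<integral>\<^sup>+ s'. G True (s, s') + G False (s, s') \<partial>?B \<partial>?B)"
    using measurable_compose[OF measurable_Pair1' G]
    by (intro nn_integral_cong nn_integral_add[symmetric]) auto
  also have "\<dots> \<le> (\<integral>\<^sup>+ s. \<integral>\<^sup>+ s'. 1 \<partial>?B \<partial>?B)"
    by (intro nn_integral_mono le)
  also have "\<dots> = 1" by (simp add: B.emeasure_space_1)
  finally have "ennreal ((1 - p) + (1 - p)) \<le> ennreal 1"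
    using p by (simp flip: ennreal_plus)
  then have "(1 - p) + (1 - p) \<le> 1" by (subst (asm) ennreal_le_iff) auto
  with p show False by simp
qed

subsection \<open>Jamming Alice\<close>

text \<open>Alice's input and seed enter only through \<open>a\<close>, the symbol that survives in
  round \<open>k\<close>. If \<open>k\<close> is a round of Bob, no symbol of Alice
  survives.\<close>

primrec jammed ::
  "('c, 'r, 's) coding_scheme \<Rightarrow> nat \<Rightarrow> 'c \<Rightarrow> 'c \<Rightarrow> (bool list \<Rightarrow> bool) \<Rightarrow> 's \<Rightarrow> nat \<Rightarrow> 'c list" where
  "jammed S k c a y s 0 = []"
| "jammed S k c a y s (Suc i) =
     (let w = jammed S k c a y s i
      in w @ [case speaker S i of
                Alice \<Rightarrow> if i = k then a else c
              | Bob \<Rightarrow> bob_send S i y s (nths w {j. speaker S j \<noteq> Bob})])"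

definition jamming_adversary :: "('c, 'r, 's) coding_scheme \<Rightarrow> nat \<Rightarrow> 'c \<Rightarrow> 'c adversary" where
  "jamming_adversary S k c w =
     (if speaker S (length w - 1) = Alice \<and> length w - 1 \<noteq> k then c else last w)"

lemma length_jammed [simp]: "length (jammed S k c a y s i) = i"
  by (induction i) (auto simp: Let_def)

lemma jammed_prefix_cong: "i \<le> k \<Longrightarrow> jammed S k c a y s i = jammed S k c a' y s i"
  by (induction i) (auto simp: Let_def split: party.split)

lemma jammed_cong:
  "speaker S k \<noteq> Alice \<Longrightarrow> jammed S k c a y s i = jammed S k c a' y s i"
  by (induction i) (auto simp: Let_def split: party.split)

lemma take_jammed: "k \<le> i \<Longrightarrow> take k (jammed S l c a y s i) = jammed S l c a y s k"
  by (induction i) (auto simp: Let_def le_Suc_eq)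

lemma jammed_in_lists:
  assumes "well_formed n S" "y \<in> bob_inputs n" "s \<in> space (bob_seed S)"
    and "a \<in> alphabet S" "c \<in> alphabet S"
  shows "i \<le> rounds S \<Longrightarrow> jammed S k c a y s i \<in> lists (alphabet S)"
proof (induction i)
  case (Suc i)
  then have w: "jammed S k c a y s i \<in> lists (alphabet S)" by simp
  have "bob_send S i y s (nths (jammed S k c a y s i) {j. speaker S j \<noteq> Bob}) \<in> alphabet S"
    if "speaker S i = Bob"
    using bob_send_in_alphabet[OF assms(1) _ that assms(2) nths_in_lists[OF w] assms(3)] Suc.prems
    by simp
  with w assms(4,5) show ?case
    by (auto simp: Let_def split: party.split)
qed simp

text \<open>Before round \<open>k\<close> the transcript does not depend on \<open>a\<close>, so
  \<open>c\<close> can stand in for \<open>a\<close> where Alice's symbol of round \<open>k\<close>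
  is computed. This avoids a circular definition of \<open>a\<close>.\<close>

lemma execution_jamming_adversary:
  assumes a: "a = alice_send S k x r (nths (jammed S k c c y s k) {j. speaker S j \<noteq> Alice})"
  shows "map snd (execution S (jamming_adversary S k c) x y r s i) = jammed S k c a y s i"
proof (induction i)
  case (Suc i)
  have "jammed S k c a y s k = jammed S k c c y s k"
    by (rule jammed_prefix_cong) simp
  with Suc a show ?case
    by (auto simp: Let_def received_by_def jamming_adversary_def split: party.split)
qed simp

lemma jamming_adversary_of_rate:
  assumes c: "c \<in> alphabet S"
    and k: "real (card {i. i < rounds S \<and> speaker S i = Alice \<and> i \<noteq> k}) \<le> \<rho> * real (rounds S)"
  shows "adversary_of_rate (alphabet S) (rounds S) \<rho> (jamming_adversary S k c)"
  unfolding adversary_of_rate_def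
proof (intro ballI impI conjI allI)
  fix w assume w: "w \<in> lists (alphabet S)" "length w = rounds S"
  have last: "last (take (Suc i) w) = w ! i" if "i < rounds S" for i
    using that w by (simp add: take_Suc_conv_app_nth)
  show "jamming_adversary S k c (take (Suc i) w) \<in> alphabet S" if i: "i < rounds S" for i
    using w i c by (auto simp: jamming_adversary_def last in_lists_conv_set)
  have "card {i. i < rounds S \<and> jamming_adversary S k c (take (Suc i) w) \<noteq> w ! i}
      \<le> card {i. i < rounds S \<and> speaker S i = Alice \<and> i \<noteq> k}"
    using w by (intro card_mono) (auto simp: jamming_adversary_def last split: if_splits)
  with k show "real (card {i. i < rounds S \<and> jamming_adversary S k c (take (Suc i) w) \<noteq> w ! i})
      \<le> \<rho> * real (rounds S)" by linarith
qed

text \<open>With the seeds fixed, \<open>y\<close> influences the guesses for all \<open>x\<close>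
  only through the table \<open>T y\<close>, which lists the transcript for each possible surviving
  symbol. The bound is the number of such tables.\<close>

lemma card_jammed_outputs_le:
  fixes S :: "('c, 'r, 's) coding_scheme"
  assumes wf: "well_formed n S" and r: "r \<in> space (alice_seed S)" and s: "s \<in> space (bob_seed S)"
    and k: "k < rounds S" and c: "c \<in> alphabet S"
  shows "card ((\<lambda>y. \<lambda>x\<in>alice_inputs n. alice_output S x r (received_by Alice S
           (execution S (jamming_adversary S k c) x y r s (rounds S)))) ` bob_inputs n)
     \<le> (card (alphabet S) ^ rounds S) ^ card (alphabet S)" (is "card (?z ` _) \<le> _")
proof -
  let ?\<Sigma> = "alphabet S" and ?N = "rounds S"
  have fin: "finite ?\<Sigma>" using wf by (simp add: well_formed_def)
  define L where "L = {w. set w \<subseteq> ?\<Sigma> \<and> length w = ?N}"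
  have L: "finite L" "card L = card ?\<Sigma> ^ ?N"
    using fin by (simp_all add: L_def finite_lists_length_eq card_lists_length_eq)
  define T where "T = (\<lambda>y. \<lambda>a\<in>?\<Sigma>. jammed S k c a y s ?N)"
  have T: "T ` bob_inputs n \<subseteq> ?\<Sigma> \<rightarrow>\<^sub>E L"
    using jammed_in_lists[OF wf _ s _ c order_refl] by (auto simp: T_def L_def in_lists_conv_set)
  \<comment> \<open>The surviving symbol is read off the table itself: all rows agree before round
    \<open>k\<close>, so row \<open>c\<close> shows what Alice has received by then. If Bob speaks
    in round \<open>k\<close>, all rows coincide and \<open>c\<close> is a default.\<close>
  define sym where "sym = (\<lambda>x \<tau>. if speaker S k = Alice
     then alice_send S k x r (nths (take k (\<tau> c)) {j. speaker S j \<noteq> Alice}) else c)"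
  define D where "D = (\<lambda>\<tau>. \<lambda>x\<in>alice_inputs n.
     alice_output S x r (nths (\<tau> (sym x \<tau>)) {j. speaker S j \<noteq> Alice}))"
  have z: "?z y = D (T y)" if y: "y \<in> bob_inputs n" for y
  proof (unfold D_def, rule restrict_ext)
    fix x assume x: "x \<in> alice_inputs n"
    define a where "a = alice_send S k x r (nths (jammed S k c c y s k) {j. speaker S j \<noteq> Alice})"
    have sym: "sym x (T y) = (if speaker S k = Alice then a else c)"
      using k c by (simp add: sym_def T_def take_jammed a_def)
    have "sym x (T y) \<in> ?\<Sigma>"
      unfolding sym a_def
      using alice_send_in_alphabet[OF wf k _ x nths_in_lists r] jammed_in_lists[OF wf y s c c] k c
      by auto
    moreover have "jammed S k c (sym x (T y)) y s ?N = jammed S k c a y s ?N"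
      unfolding sym using jammed_cong[of S k c c y s ?N a] by auto
    ultimately show "alice_output S x r (received_by Alice S
           (execution S (jamming_adversary S k c) x y r s (rounds S))) =
       alice_output S x r (nths (T y (sym x (T y))) {j. speaker S j \<noteq> Alice})"
      by (simp add: received_by_def execution_jamming_adversary[OF a_def] T_def)
  qed
  have fT: "finite (?\<Sigma> \<rightarrow>\<^sub>E L)" using fin L by (simp add: finite_PiE)
  have "?z ` bob_inputs n = D ` T ` bob_inputs n" using z by (auto simp: image_image)
  also have "card \<dots> \<le> card (T ` bob_inputs n)" by (intro card_image_le) simp
  also have "\<dots> \<le> card (?\<Sigma> \<rightarrow>\<^sub>E L)" by (rule card_mono[OF fT T])
  also have "\<dots> = (card ?\<Sigma> ^ ?N) ^ card ?\<Sigma>" using fin L by (simp add: card_PiE)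
  finally show ?thesis .
qed

section \<open>Few guess vectors against uniformly random bits\<close>

text \<open>Compares the moment of \<open>(1/4) ^ d\<close>, \<open>d\<close> the Hamming distance, over uniformly random \<open>y\<close> with its
  lower bound from Jensen's inequality.\<close>

lemma few_guesses_bound:
  fixes z :: "('a \<Rightarrow> bool) \<Rightarrow> 'a \<Rightarrow> bool"
  assumes X: "finite X" "card X = 4 * m"
    and dist: "(\<Sum>y\<in>X \<rightarrow>\<^sub>E UNIV. card {x\<in>X. z y x \<noteq> y x}) \<le> m * 2 ^ (4 * m)"
  shows "(1024/625) ^ m \<le> real (card (z ` (X \<rightarrow>\<^sub>E UNIV)))"
proof -
  let ?Y = "X \<rightarrow>\<^sub>E (UNIV :: bool set)"
  have Y: "finite ?Y" "card ?Y = 2 ^ (4 * m)" using X by (simp_all add: finite_PiE card_PiE)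
  define d where "d = (\<lambda>v y. card {x\<in>X. v x \<noteq> (y x :: bool)})"
  \<comment> \<open>The sum factors over the coordinates; in each, one bit agrees and one differs,
    which gives \<open>1 + 1/4\<close>.\<close>
  have moment: "(\<Sum>y\<in>?Y. (1/4 :: real) ^ d v y) = (5/4) ^ (4 * m)" for v
  proof -
    have "(\<Sum>y\<in>?Y. (1/4 :: real) ^ d v y) = (\<Sum>y\<in>?Y. \<Prod>x\<in>X. if v x \<noteq> y x then 1/4 else 1)"
      using X by (simp add: d_def flip: prod.inter_filter)
    also have "\<dots> = (\<Prod>x\<in>X. \<Sum>b\<in>UNIV. if v x \<noteq> b then 1/4 else 1)"
      using X by (subst prod_sum_PiE) auto
    also have "\<dots> = (\<Prod>x\<in>X. 5/4)" by (intro prod.cong) (auto simp: UNIV_bool)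
    finally show ?thesis using X by simp
  qed
  \<comment> \<open>Tangent of the convex function \<open>(1/4) ^ e\<close> at \<open>e = m\<close>,
    the assumed bound on the average distance.\<close>
  have tangent: "(1/4) ^ m * (1 + ln 4 * (real m - real e)) \<le> (1/4 :: real) ^ e" for e
  proof -
    have pw: "(1/4 :: real) ^ j = exp (- ln 4 * real j)" for j
      unfolding exp_of_nat2_mult by (simp add: exp_minus inverse_eq_divide)
    have "1 + ln 4 * (real m - real e) \<le> exp (ln 4 * (real m - real e))" by (rule exp_ge_add_one_self)
    then have "(1/4) ^ m * (1 + ln 4 * (real m - real e)) \<le> (1/4) ^ m * exp (ln 4 * (real m - real e))"
      by (intro mult_left_mono) auto
    also have "\<dots> = (1/4) ^ e" by (simp add: pw algebra_simps flip: exp_add)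
    finally show ?thesis .
  qed
  have "(1/4 :: real) ^ m * 2 ^ (4 * m)
      \<le> (1/4) ^ m * (2 ^ (4 * m) + ln 4 * (real m * 2 ^ (4 * m) - real (\<Sum>y\<in>?Y. d (z y) y)))"
  proof -
    have "real (\<Sum>y\<in>?Y. d (z y) y) \<le> real (m * 2 ^ (4 * m))"
      using dist unfolding d_def of_nat_le_iff .
    then show ?thesis by simp
  qed
  also have "\<dots> = (\<Sum>y\<in>?Y. (1/4) ^ m * (1 + ln 4 * (real m - real (d (z y) y))))"
    using Y by (simp add: sum_subtractf sum.distrib flip: sum_distrib_left)
  also have "\<dots> \<le> (\<Sum>y\<in>?Y. (1/4) ^ d (z y) y)" by (intro sum_mono tangent)
  \<comment> \<open>Summing over all possible guess vectors decouples the guess from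
    \<open>y\<close>.\<close>
  also have "\<dots> \<le> (\<Sum>y\<in>?Y. \<Sum>v\<in>z ` ?Y. (1/4) ^ d v y)"
    using Y by (intro sum_mono member_le_sum) auto
  also have "\<dots> = real (card (z ` ?Y)) * (5/4) ^ (4 * m)"
    by (subst sum.swap) (simp add: moment)
  \<comment> \<open>Here \<open>(1/4) ^ m * 2 ^ (4 * m) = 4 ^ m\<close> and
    \<open>(5/4) ^ 4 = 625/256\<close>; their quotient has base \<open>1024/625\<close>, which
    exceeds 1.\<close>
  finally have "(4 :: real) ^ m \<le> real (card (z ` ?Y)) * (625/256) ^ m"
    by (simp add: power_mult power4_eq_xxxx flip: power_mult_distrib)
  then have "(4 :: real) ^ m / (625/256) ^ m \<le> real (card (z ` ?Y))" by (simp add: divide_le_eq)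
  then show ?thesis by (simp flip: power_divide)
qed

text \<open>First moment argument: the expected number of events that occur exceeds
  \<open>q * card I\<close>.\<close>

lemma (in prob_space) exists_outcome_in_many_events:
  assumes "finite I" "\<And>i. i \<in> I \<Longrightarrow> E i \<in> events" "\<And>i. i \<in> I \<Longrightarrow> q < prob (E i)" "I \<noteq> {}"
  shows "\<exists>\<omega>\<in>space M. q * real (card I) < real (card {i\<in>I. \<omega> \<in> E i})"
proof (rule ccontr)
  assume "\<not> ?thesis"
  then have le: "real (card {i\<in>I. \<omega> \<in> E i}) \<le> q * real (card I)" if "\<omega> \<in> space M" for \<omega>
    using that by force
  have card: "real (card {i\<in>I. \<omega> \<in> E i}) = (\<Sum>i\<in>I. indicator (E i) \<omega>)" for \<omega>
    using assms(1) by (simp add: indicator_def sum.If_cases Int_def)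
  have "q * real (card I) = (\<Sum>i\<in>I. q)" by simp
  also have "\<dots> < (\<Sum>i\<in>I. prob (E i))" using assms by (intro sum_strict_mono) auto
  also have "\<dots> = (\<Sum>i\<in>I. \<integral>\<omega>. indicator (E i) \<omega> \<partial>M)" using assms by simp
  also have "\<dots> = (\<integral>\<omega>. (\<Sum>i\<in>I. indicator (E i) \<omega>) \<partial>M)"
    using assms by (intro Bochner_Integration.integral_sum[symmetric]) (auto simp: emeasure_eq_measure)
  also have "\<dots> \<le> (\<integral>\<omega>. q * real (card I) \<partial>M)"
    using assms le by (intro integral_mono)
      (auto simp: card emeasure_eq_measure intro!: Bochner_Integration.integrable_sum)
  also have "\<dots> = q * real (card I)" by (simp add: prob_space)
  finally show False by simp
qed

text \<open>Averaging over all pairs \<open>(y, x)\<close> yields one pair of seeds for which more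
  than three quarters of the guesses are right. The average Hamming distance is then at most
  \<open>2 ^ (n - 2)\<close>, so there must be many guess vectors, while jamming permits
  few.\<close>

lemma size_bound_of_jamming:
  assumes scheme: "one_sided_unique_decoding_scheme n \<rho> p S" and p: "p < 1/4" and n: "n \<ge> 2"
    and k: "k < rounds S"
      "real (card {i. i < rounds S \<and> speaker S i = Alice \<and> i \<noteq> k}) \<le> \<rho> * real (rounds S)"
  shows "(1024/625) ^ 2 ^ (n - 2) \<le> (real (card (alphabet S)) ^ rounds S) ^ card (alphabet S)"
proof -
  let ?A = "alice_seed S" and ?B = "bob_seed S" and ?\<Sigma> = "alphabet S"
  let ?X = "alice_inputs n" and ?Y = "bob_inputs n"
  have wf: "well_formed n S" using scheme by (simp add: one_sided_unique_decoding_scheme_def)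
  interpret A: prob_space ?A using wf by (simp add: well_formed_def)
  interpret B: prob_space ?B using wf by (simp add: well_formed_def)
  interpret AB: pair_prob_space ?A ?B ..
  obtain r0 s0 where rs0: "r0 \<in> space ?A" "s0 \<in> space ?B" using A.not_empty B.not_empty by blast
  have X: "replicate n False \<in> ?X" by (simp add: alice_inputs_def)
  have Y: "(\<lambda>x\<in>?X. False) \<in> ?Y" by (auto simp: bob_inputs_def)
  \<comment> \<open>The alphabet has a symbol to jam with, since whoever speaks in round
    \<open>k\<close> sends one.\<close>
  obtain c where c: "c \<in> ?\<Sigma>"
  proof (cases "speaker S k")
    case Alice
    from that[OF alice_send_in_alphabet[OF wf k(1) this X lists.Nil rs0(1)]] show ?thesis .
  next
    case Bob
    from that[OF bob_send_in_alphabet[OF wf k(1) this Y lists.Nil rs0(2)]] show ?thesis .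
  qed
  define adv where "adv = jamming_adversary S k c"
  define E where "E = (\<lambda>(y, x). {(r, s) \<in> space (?A \<Otimes>\<^sub>M ?B). alice_decodes S adv x y r s})"
  have prob: "AB.P.prob (E yx) \<ge> 1 - p" if "yx \<in> ?Y \<times> ?X" for yx
    using that scheme jamming_adversary_of_rate[OF c k(2)]
    unfolding one_sided_unique_decoding_scheme_def E_def adv_def by (auto simp del: space_pair_measure)
  have ev: "E yx \<in> AB.P.events" if "yx \<in> ?Y \<times> ?X" for yx
    using prob[OF that] p measure_notin_sets[of "E yx" "?A \<Otimes>\<^sub>M ?B"] by force
  have "\<exists>\<omega>\<in>space (?A \<Otimes>\<^sub>M ?B). 3/4 * real (card (?Y \<times> ?X)) < real (card {yx\<in>?Y \<times> ?X. \<omega> \<in> E yx})"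
  proof (rule AB.P.exists_outcome_in_many_events)
    show "3/4 < AB.P.prob (E yx)" if "yx \<in> ?Y \<times> ?X" for yx using prob[OF that] p by linarith
  qed (use X Y ev in auto)
  then obtain r s where rs: "r \<in> space ?A" "s \<in> space ?B"
    and many: "3/4 * real (card (?Y \<times> ?X)) < real (card {yx\<in>?Y \<times> ?X. (r, s) \<in> E yx})"
    by (auto simp: space_pair_measure)
  define z where "z = (\<lambda>y. \<lambda>x\<in>?X. alice_output S x r (received_by Alice S
           (execution S adv x y r s (rounds S))))"
  have good: "{yx\<in>?Y \<times> ?X. (r, s) \<in> E yx} = {yx\<in>?Y \<times> ?X. z (fst yx) (snd yx) = fst yx (snd yx)}"
    using rs by (auto simp: E_def z_def alice_decodes_def one_lookup_def space_pair_measure)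
  have "card {yx\<in>?Y \<times> ?X. (r, s) \<in> E yx} + card {yx\<in>?Y \<times> ?X. z (fst yx) (snd yx) \<noteq> fst yx (snd yx)}
      = card ({yx\<in>?Y \<times> ?X. (r, s) \<in> E yx} \<union> {yx\<in>?Y \<times> ?X. z (fst yx) (snd yx) \<noteq> fst yx (snd yx)})"
    unfolding good by (subst card_Un_disjoint) auto
  also have "{yx\<in>?Y \<times> ?X. (r, s) \<in> E yx} \<union> {yx\<in>?Y \<times> ?X. z (fst yx) (snd yx) \<noteq> fst yx (snd yx)} = ?Y \<times> ?X"
    unfolding good by blast
  finally have "card {yx\<in>?Y \<times> ?X. (r, s) \<in> E yx} +
      card {yx\<in>?Y \<times> ?X. z (fst yx) (snd yx) \<noteq> fst yx (snd yx)} = card (?Y \<times> ?X)" .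
  with many have bad: "4 * card {yx\<in>?Y \<times> ?X. z (fst yx) (snd yx) \<noteq> fst yx (snd yx)} \<le> card (?Y \<times> ?X)"
    by linarith
  have "{yx\<in>?Y \<times> ?X. z (fst yx) (snd yx) \<noteq> fst yx (snd yx)} = Sigma ?Y (\<lambda>y. {x\<in>?X. z y x \<noteq> y x})"
    by auto
  then have sum: "card {yx\<in>?Y \<times> ?X. z (fst yx) (snd yx) \<noteq> fst yx (snd yx)}
      = (\<Sum>y\<in>?Y. card {x\<in>?X. z y x \<noteq> y x})" by simp
  \<comment> \<open>The counting bound wants \<open>4 * m\<close> coordinates, and
    \<open>n \<ge> 2\<close> makes \<open>2 ^ n\<close> a multiple of 4.\<close>
  have m: "4 * 2 ^ (n - 2) = (2 :: nat) ^ n" using n by (auto simp: le_iff_add power_add)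
  have "(1024/625) ^ 2 ^ (n - 2) \<le> real (card (z ` (?X \<rightarrow>\<^sub>E UNIV)))"
  proof (rule few_guesses_bound)
    show "card ?X = 4 * 2 ^ (n - 2)" by (simp add: card_alice_inputs m)
    have "card (?Y \<times> ?X) = 4 * (2 ^ (n - 2) * 2 ^ (4 * 2 ^ (n - 2)))"
      unfolding m using m by (simp add: card_cartesian_product card_alice_inputs card_bob_inputs)
    with bad sum show "(\<Sum>y\<in>?X \<rightarrow>\<^sub>E UNIV. card {x\<in>?X. z y x \<noteq> y x}) \<le> 2 ^ (n - 2) * 2 ^ (4 * 2 ^ (n - 2))"
      unfolding bob_inputs_def by linarith
  qed simp
  also have "\<dots> \<le> real ((card ?\<Sigma> ^ rounds S) ^ card ?\<Sigma>)"
    using card_jammed_outputs_le[OF wf rs k(1) c]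
    unfolding z_def adv_def bob_inputs_def of_nat_le_iff .
  finally show ?thesis by simp
qed

section \<open>Choice between the two attacks, and asymptotics\<close>

text \<open>Either Bob's rounds split into two sets of at most \<open>t\<close> rounds, which mixing
  rules out, or all but one of Alice's rounds can be jammed.\<close>

lemma scheme_size_bound:
  assumes scheme: "one_sided_unique_decoding_scheme n (1/3) p S" and p: "p < 1/4" and n: "n \<ge> 2"
  shows "(1024/625) ^ 2 ^ (n - 2) \<le> (real (card (alphabet S)) ^ rounds S) ^ card (alphabet S)"
proof -
  define t where "t = rounds S div 3"
  let ?RA = "{i. i < rounds S \<and> speaker S i = Alice}" and ?RB = "{i. i < rounds S \<and> speaker S i = Bob}"
  have t: "real j \<le> 1/3 * real (rounds S)" if "j \<le> t" for j
    using that unfolding t_def by linarith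
  have "?RA \<union> ?RB = {..<rounds S}" by (auto, metis party.exhaust)
  moreover have "card ?RA + card ?RB = card (?RA \<union> ?RB)" by (subst card_Un_disjoint) auto
  ultimately have N: "card ?RA + card ?RB = rounds S" by (simp only: card_lessThan)
  have B: "\<not> card ?RB \<le> 2 * t"
  proof
    assume le: "card ?RB \<le> 2 * t"
    obtain J where J: "J \<subseteq> ?RB" "card J = min t (card ?RB)"
      using obtain_subset_with_card_n[of "min t (card ?RB)" ?RB] by auto
    have "?RB - J = {i. i < rounds S \<and> speaker S i = Bob \<and> i \<notin> J}" by auto
    moreover have "card (?RB - J) \<le> t"
      using J le by (subst card_Diff_subset) (auto intro: finite_subset)
    moreover have "{i. i < rounds S \<and> speaker S i = Bob \<and> i \<in> J} = J" using J by auto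
    ultimately have "p \<ge> 1/2"
      using J by (intro failure_probability_of_mixing[OF scheme, of J]) (simp_all only: t min.cobounded1)
    with p show False by simp
  qed
  \<comment> \<open>Bob speaks at least \<open>2 * t + 1\<close> times, and
    \<open>rounds S \<le> 3 * t + 2\<close>.\<close>
  with N have A: "card ?RA \<le> t + 1" unfolding t_def by linarith
  have "\<exists>k < rounds S. card {i. i < rounds S \<and> speaker S i = Alice \<and> i \<noteq> k} \<le> t"
  proof (cases "?RA = {}")
    \<comment> \<open>Alice never speaks, so \<open>k = 0\<close> serves; round 0 exists because Bob
      speaks.\<close>
    case True
    have "{i. i < rounds S \<and> speaker S i = Alice \<and> i \<noteq> 0} = {}" using True by blast
    moreover have "rounds S > 0" using B N by linarith
    ultimately show ?thesis by (intro exI[of _ 0]) (simp only: card.empty, simp)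
  next
    case False
    then obtain k where k: "k \<in> ?RA" by blast
    have "{i. i < rounds S \<and> speaker S i = Alice \<and> i \<noteq> k} = ?RA - {k}" by auto
    with k A show ?thesis by (intro exI[of _ k]) simp
  qed
  with t show ?thesis using size_bound_of_jamming[OF scheme p n] by blast
qed

theorem theorem12:
  "\<not> (\<exists>(S :: nat \<Rightarrow> ('c, 'r, 's) coding_scheme) (p :: nat \<Rightarrow> real) (f :: nat \<Rightarrow> real).
        (\<forall>n\<ge>1. one_sided_unique_decoding_scheme n (1/3) (p n) (S n)) \<and>
        (\<lambda>n. real (card (alphabet (S n)))) \<in> o(\<lambda>n. real n) \<and>
        f \<in> o(\<lambda>n. real n) \<and> (\<forall>n\<ge>1. real (rounds (S n)) \<le> 2 powr f n) \<and>
        p \<in> o(\<lambda>n. 1))"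
proof (rule notI, elim exE conjE)
  fix S :: "nat \<Rightarrow> ('c, 'r, 's) coding_scheme" and p f :: "nat \<Rightarrow> real"
  assume scheme: "\<forall>n\<ge>1. one_sided_unique_decoding_scheme n (1/3) (p n) (S n)"
    and alph: "(\<lambda>n. real (card (alphabet (S n)))) \<in> o(\<lambda>n. real n)"
    and f: "f \<in> o(\<lambda>n. real n)" and rounds: "\<forall>n\<ge>1. real (rounds (S n)) \<le> 2 powr f n"
    and p: "p \<in> o(\<lambda>n. 1)"
  \<comment> \<open>Any constant below the threshold \<open>1/4\<close> of
    \<open>scheme_size_bound\<close> would do.\<close>
  have "eventually (\<lambda>n. norm (p n) \<le> 1/5 * norm (1 :: real)) at_top"
    using landau_o.smallD[OF p, of "1/5"] by simp
  moreover have "eventually (\<lambda>n. card (alphabet (S n)) \<le> n) at_top"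
    using landau_o.smallD[OF alph, of 1] by simp
  moreover have "eventually (\<lambda>n. norm (f n) \<le> 1/4 * norm (real n)) at_top"
    using landau_o.smallD[OF f, of "1/4"] by simp
  \<comment> \<open>The left side will bound the binary logarithm of the number of tables; the
    factor \<open>1/8\<close> matches \<open>l = n - 3\<close> below.\<close>
  moreover have "eventually (\<lambda>n::nat. real n * 2 powr (1/4 * real n) * real n < 2 powr real n / 8) at_top"
    by real_asymp
  moreover have "eventually (\<lambda>n. n \<ge> (3 :: nat)) at_top" by (rule eventually_ge_at_top)
  ultimately have "eventually (\<lambda>n::nat. False) at_top"
  proof eventually_elim
    case (elim n)
    let ?N = "rounds (S n)" and ?a = "card (alphabet (S n))"
    obtain l where l: "n = l + 3" using elim(5) by (metis add.commute le_Suc_ex)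
    have "real ?N \<le> 2 powr f n" using rounds elim(5) by simp
    also have "\<dots> \<le> 2 powr (1/4 * real n)" using elim(3) by (intro powr_mono) auto
    finally have "real n * real ?N * real n \<le> real n * 2 powr (1/4 * real n) * real n"
      by (intro mult_mono) auto
    also have "\<dots> < 2 powr real n / 8" by (rule elim(4))
    also have "\<dots> = real (2 ^ l)" by (simp add: l powr_add powr_realpow)
    finally have lt: "n * ?N * n < 2 ^ l" by (simp only: of_nat_less_iff flip: of_nat_mult)
    \<comment> \<open>Since \<open>2 ^ (n - 2) = 2 * 2 ^ l\<close>, one factor 2 of the exponent can
      be spent on squaring \<open>1024/625\<close>, whose square exceeds 2.\<close>
    have "(2 :: real) ^ 2 ^ l \<le> ((1024/625) ^ 2) ^ 2 ^ l" by (intro power_mono) (auto simp: power2_eq_square)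
    also have "\<dots> = (1024/625) ^ 2 ^ (n - 2)" by (simp add: l flip: power_mult)
    also have "\<dots> \<le> (real ?a ^ ?N) ^ ?a"
      using scheme elim(1,5) by (intro scheme_size_bound[of n "p n"]) auto
    also have "\<dots> = real ((?a ^ ?N) ^ ?a)" by simp
    also have "\<dots> \<le> real (2 ^ (n * ?N * n))"
    proof -
      have "?a \<le> 2 ^ n" using elim(2) less_exp[of n] by linarith
      then have "(?a ^ ?N) ^ ?a \<le> ((2 ^ n) ^ ?N) ^ ?a" by (intro power_mono) auto
      also have "\<dots> \<le> ((2 ^ n) ^ ?N) ^ n" using elim(2) by (intro power_increasing) auto
      also have "\<dots> = 2 ^ (n * ?N * n)" by (simp only: power_mult)
      finally show ?thesis by (simp only: of_nat_le_iff)
    qed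
    also have "\<dots> < 2 ^ 2 ^ l" using lt by simp
    finally show False by simp
  qed
  then show False by simp
qed

end
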